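(* There is a universal constant $c>0$ such that for all $0\le\alpha\le1$, $n\ge1$, $V>0$ and $\sigma>0$, with $m=\lceil n^\alpha\rceil$, $$\inf_{\tilde\mu}\ \sup_{\mu\in\mathcal F_{n,\alpha,V}}\mathbb E\,\frac1n\|\tilde\mu-\mu\|^2\ \ge\ \sup_{\substack{(v_1,\dots,v_m):\ v_i\ge0,\\ \sum_{i=1}^mv_i\le V}}\ \frac cn\sum_{i=1}^m\min\Bigl\{n^{1-\alpha}\sigma^2,\ (v_i\sigma^2)^{2/3}n^{(1-\alpha)/3},\ n^{1-\alpha}v_i^2\Bigr\},$$ where the infimum is over all estimators $\tilde\mu=\tilde\mu(Y)$.
   Context: For $0\le\alpha\le1$ and a positive integer $n$, put $m=\lceil n^\alpha\rceil$ and $l=\lceil n^{1-\alpha}\rceil$. The rooted tree $\mathcal T_{\alpha,n}$ has a root with $m$ children, each of which is the first vertex of a path with $l$ vertices; it has $lm+1=\Theta(n)$ vertices. A flow $\mu$ on it consists of a root value $\mu_1$ and values $\mu^{(j)}_i$ ($1\le j\le m$, $1\le i\le l$) along the paths, satisfying $\mu_1\ge\sum_{j=1}^m\mu^{(j)}_1$ and $\mu^{(j)}_1\ge\mu^{(j)}_2\ge\cdots\ge\mu^{(j)}_l\ge0$ for each $j$. $\mathcal F_{n,\alpha,V}$ is the set of flows on $\mathcal T_{\alpha,n}$ with $\mu_1\le V$. The data are $Y=\mu+\epsilon$ with one independent $N(0,\sigma^2)$ error at each vertex; an estimator is a measurable function of $Y$ with real values at the vertices. $\|\cdot\|$ is the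 Euclidean norm over all vertices, and $\mathbb E$ is expectation under the true $\mu$. *)

theory Defs
  imports "HOL-Probability.Probability"
begin

definition num_paths :: "real \<Rightarrow> nat \<Rightarrow> nat" where
  "num_paths \<alpha> n = nat \<lceil>real n powr \<alpha>\<rceil>"

definition path_length :: "real \<Rightarrow> nat \<Rightarrow> nat" where
  "path_length \<alpha> n = nat \<lceil>real n powr (1 - \<alpha>)\<rceil>"

text \<open>
  \<open>Node j i\<close> is the \<open>i\<close>-th vertex of the \<open>j\<close>-th path; both indices start at 1,
  and \<open>Node j 1\<close> is the child of the root.
\<close>

datatype vertex = Root | Node nat nat

definition tree_vertices :: "real \<Rightarrow> nat \<Rightarrow> vertex set" where
  "tree_vertices \<alpha> n =
     insert Root {Node j i |j i. j \<in> {1..num_paths \<alpha> n} \<and> i \<in> {1..path_length \<alpha> n}}"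

definition flows :: "real \<Rightarrow> nat \<Rightarrow> (vertex \<Rightarrow> real) set" where
  "flows \<alpha> n =
     {\<mu> \<in> tree_vertices \<alpha> n \<rightarrow>\<^sub>E UNIV.
        (\<Sum>j = 1..num_paths \<alpha> n. \<mu> (Node j 1)) \<le> \<mu> Root \<and>
        (\<forall>j \<in> {1..num_paths \<alpha> n}.
           (\<forall>i \<in> {1..<path_length \<alpha> n}. \<mu> (Node j (Suc i)) \<le> \<mu> (Node j i)) \<and>
           0 \<le> \<mu> (Node j (path_length \<alpha> n)))}"

definition bounded_flows :: "real \<Rightarrow> nat \<Rightarrow> real \<Rightarrow> (vertex \<Rightarrow> real) set" where
  "bounded_flows \<alpha> n V = {\<mu> \<in> flows \<alpha> n. \<mu> Root \<le> V}"

definition noise :: "real \<Rightarrow> nat \<Rightarrow> real \<Rightarrow> (vertex \<Rightarrow> real) measure" where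
  "noise \<alpha> n \<sigma> = (\<Pi>\<^sub>M x\<in>tree_vertices \<alpha> n. density lborel (normal_density 0 \<sigma>))"

definition observation ::
    "real \<Rightarrow> nat \<Rightarrow> (vertex \<Rightarrow> real) \<Rightarrow> (vertex \<Rightarrow> real) \<Rightarrow> (vertex \<Rightarrow> real)" where
  "observation \<alpha> n \<mu> \<epsilon> = (\<lambda>x\<in>tree_vertices \<alpha> n. \<mu> x + \<epsilon> x)"

definition estimators :: "real \<Rightarrow> nat \<Rightarrow> ((vertex \<Rightarrow> real) \<Rightarrow> (vertex \<Rightarrow> real)) set" where
  "estimators \<alpha> n =
     measurable (\<Pi>\<^sub>M x\<in>tree_vertices \<alpha> n. borel) (\<Pi>\<^sub>M x\<in>tree_vertices \<alpha> n. borel)"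

text \<open>
  The risk takes values in \<^typ>\<open>ennreal\<close>, since an arbitrary estimator may have infinite
  mean squared error. It is normalised by \<open>n\<close>, not by the number of vertices.
\<close>

definition risk ::
    "real \<Rightarrow> nat \<Rightarrow> real \<Rightarrow> ((vertex \<Rightarrow> real) \<Rightarrow> (vertex \<Rightarrow> real)) \<Rightarrow> (vertex \<Rightarrow> real) \<Rightarrow> ennreal" where
  "risk \<alpha> n \<sigma> T \<mu> =
     (\<integral>\<^sup>+ \<epsilon>. ennreal (1 / real n *
        (L2_set (\<lambda>x. T (observation \<alpha> n \<mu> \<epsilon>) x - \<mu> x) (tree_vertices \<alpha> n))\<^sup>2)
      \<partial>noise \<alpha> n \<sigma>)"

end

theory Submission imports Defs
begin

text \<open>
  Assouad's method. Cut path \<open>j\<close> into blocks of length \<open>s\<close> and consider a staircase with steps of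
  height \<open>h\<close>, each block being raised by \<open>h\<close> or not; all these flows are admissible when
  \<open>h\<close> times the number of blocks is at most \<open>v\<^sub>j\<close>. If \<open>s * h\<^sup>2 \<le> \<sigma>\<^sup>2\<close>, two flows that differ in
  one block cannot be told apart reliably, so every vertex contributes a constant times \<open>h\<^sup>2\<close> to
  the average risk over the cube, whence a bound of order \<open>l * h\<^sup>2\<close> for the path. The three terms of
  the minimum correspond to the optimal block lengths \<open>1\<close>, \<open>(l * \<sigma> / v)\<^bsup>2/3\<^esup>\<close> and \<open>l\<close>.
\<close>

section \<open>Gaussian product measures: densities and shifts\<close>

text \<open>Finite product measures are determined by boxes, and on a box the integral of a product
  of one-variable functions factorises.\<close>

lemma density_PiM_prod:
  assumes I: "finite I" and M: "product_sigma_finite M"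
    and D: "product_sigma_finite (\<lambda>i. density (M i) (f i))"
    and f [measurable]: "\<And>i. f i \<in> borel_measurable (M i)"
  shows "density (PiM I M) (\<lambda>y. \<Prod>i\<in>I. f i (y i)) = PiM I (\<lambda>i. density (M i) (f i))"
proof -
  interpret M: product_sigma_finite M by (rule M)
  interpret D: product_sigma_finite "\<lambda>i. density (M i) (f i)" by (rule D)
  show ?thesis
  proof (rule D.PiM_eqI[OF I])
    show "sets (density (PiM I M) (\<lambda>y. \<Prod>i\<in>I. f i (y i))) = sets (PiM I (\<lambda>i. density (M i) (f i)))"
      by (simp cong: sets_PiM_cong)
  next
    fix A assume "\<And>i. i \<in> I \<Longrightarrow> A i \<in> sets (density (M i) (f i))"
    then have A [measurable]: "\<And>i. i \<in> I \<Longrightarrow> A i \<in> sets (M i)" by simp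
    have box [measurable]: "Pi\<^sub>E I A \<in> sets (PiM I M)"
      using I A by (rule sets_PiM_I_finite)
    have "emeasure (density (PiM I M) (\<lambda>y. \<Prod>i\<in>I. f i (y i))) (Pi\<^sub>E I A)
      = (\<integral>\<^sup>+ y. (\<Prod>i\<in>I. f i (y i)) * indicator (Pi\<^sub>E I A) y \<partial>PiM I M)"
      by (rule emeasure_density) (use I in measurable)
    also have "\<dots> = (\<integral>\<^sup>+ y. (\<Prod>i\<in>I. f i (y i) * indicator (A i) (y i)) \<partial>PiM I M)"
    proof (rule nn_integral_cong)
      fix y assume "y \<in> space (PiM I M)"
      then have "indicator (Pi\<^sub>E I A) y = (\<Prod>i\<in>I. indicator (A i) (y i) :: ennreal)"
        using I by (auto simp: indicator_def space_PiM PiE_iff)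
      then show "(\<Prod>i\<in>I. f i (y i)) * indicator (Pi\<^sub>E I A) y
        = (\<Prod>i\<in>I. f i (y i) * indicator (A i) (y i))"
        by (simp add: prod.distrib)
    qed
    also have "\<dots> = (\<Prod>i\<in>I. \<integral>\<^sup>+ t. f i t * indicator (A i) t \<partial>M i)"
      using I by (rule M.product_nn_integral_prod) measurable
    also have "\<dots> = (\<Prod>i\<in>I. emeasure (density (M i) (f i)) (A i))"
      by (intro prod.cong refl emeasure_density[symmetric]) auto
    finally show "emeasure (density (PiM I M) (\<lambda>y. \<Prod>i\<in>I. f i (y i))) (Pi\<^sub>E I A)
      = (\<Prod>i\<in>I. emeasure (density (M i) (f i)) (A i))" .
  qed
qed

lemma product_sigma_finite_gaussian:
  assumes "\<sigma> > 0"
  shows "product_sigma_finite (\<lambda>i. density lborel (\<lambda>t. ennreal (normal_density (\<mu> i) \<sigma> t)))"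
  using prob_space_normal_density[OF assms]
  by (auto simp: product_sigma_finite_def prob_space_imp_sigma_finite)

lemma emeasure_gaussian_shift:
  assumes [measurable]: "B \<in> sets borel"
  shows "emeasure (density lborel (\<lambda>t. ennreal (normal_density 0 \<sigma> t))) ((\<lambda>e. c + e) -` B)
    = emeasure (density lborel (\<lambda>t. ennreal (normal_density c \<sigma> t))) B"
proof -
  have S [measurable]: "(\<lambda>e. c + e) -` B \<in> sets borel"
    using measurable_sets_borel[of "\<lambda>e. c + e" borel B] by simp
  show ?thesis
    using nn_integral_real_affine[of "\<lambda>t. ennreal (normal_density c \<sigma> t) * indicator B t" 1 c]
    by (simp add: emeasure_density normal_density_def indicator_def)
qed

text \<open>Expresses the laws of the data for all means as densities with respect to one Lebesgue
  measure, so that two of them can be compared pointwise under a single integral.\<close>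

lemma distr_shift_gaussian_PiM:
  assumes I: "finite I" and \<sigma>: "\<sigma> > 0"
  shows "distr (PiM I (\<lambda>_. density lborel (\<lambda>t. ennreal (normal_density 0 \<sigma> t)))) (PiM I (\<lambda>_. borel))
      (\<lambda>\<epsilon>. \<lambda>i\<in>I. \<mu> i + \<epsilon> i)
    = density (PiM I (\<lambda>_. lborel)) (\<lambda>y. ennreal (\<Prod>i\<in>I. normal_density (\<mu> i) \<sigma> (y i)))"
    (is "distr ?N _ ?g = _")
proof -
  interpret N: product_sigma_finite "\<lambda>_. density lborel (\<lambda>t. ennreal (normal_density 0 \<sigma> t))"
    using product_sigma_finite_gaussian[OF \<sigma>, of "\<lambda>_. 0"] .
  interpret D: product_sigma_finite "\<lambda>i. density lborel (\<lambda>t. ennreal (normal_density (\<mu> i) \<sigma> t))"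
    using product_sigma_finite_gaussian[OF \<sigma>] .
  have [measurable]: "?g \<in> measurable ?N (PiM I (\<lambda>_. borel))"
    by measurable
  have "distr ?N (PiM I (\<lambda>_. borel)) ?g
    = PiM I (\<lambda>i. density lborel (\<lambda>t. ennreal (normal_density (\<mu> i) \<sigma> t)))"
  proof (rule D.PiM_eqI[OF I])
    show "sets (distr ?N (PiM I (\<lambda>_. borel)) ?g)
      = sets (PiM I (\<lambda>i. density lborel (\<lambda>t. ennreal (normal_density (\<mu> i) \<sigma> t))))"
      by (simp cong: sets_PiM_cong)
  next
    fix A assume "\<And>i. i \<in> I \<Longrightarrow> A i \<in> sets (density lborel (\<lambda>t. ennreal (normal_density (\<mu> i) \<sigma> t)))"
    then have A: "\<And>i. i \<in> I \<Longrightarrow> A i \<in> sets borel" by simp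
    have A': "(\<lambda>e. \<mu> i + e) -` A i \<in> sets borel" if "i \<in> I" for i
      using measurable_sets_borel[of "\<lambda>e. \<mu> i + e" borel "A i"] A[OF that] by simp
    have "?g -` Pi\<^sub>E I A \<inter> space ?N = Pi\<^sub>E I (\<lambda>i. (\<lambda>e. \<mu> i + e) -` A i)"
      by (auto simp: space_PiM PiE_iff)
    then have "emeasure (distr ?N (PiM I (\<lambda>_. borel)) ?g) (Pi\<^sub>E I A)
      = emeasure ?N (Pi\<^sub>E I (\<lambda>i. (\<lambda>e. \<mu> i + e) -` A i))"
      using A I by (subst emeasure_distr) (auto intro!: sets_PiM_I_finite)
    also have "\<dots> = (\<Prod>i\<in>I. emeasure (density lborel (\<lambda>t. ennreal (normal_density 0 \<sigma> t)))
        ((\<lambda>e. \<mu> i + e) -` A i))"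
      by (rule N.emeasure_PiM[OF I]) (use A' in simp)
    also have "\<dots> = (\<Prod>i\<in>I. emeasure (density lborel (\<lambda>t. ennreal (normal_density (\<mu> i) \<sigma> t))) (A i))"
      by (intro prod.cong refl emeasure_gaussian_shift A)
    finally show "emeasure (distr ?N (PiM I (\<lambda>_. borel)) ?g) (Pi\<^sub>E I A)
      = (\<Prod>i\<in>I. emeasure (density lborel (\<lambda>t. ennreal (normal_density (\<mu> i) \<sigma> t))) (A i))" .
  qed
  also have "\<dots> = density (PiM I (\<lambda>_. lborel)) (\<lambda>y. \<Prod>i\<in>I. ennreal (normal_density (\<mu> i) \<sigma> (y i)))"
    by (rule density_PiM_prod[symmetric, OF I _ product_sigma_finite_gaussian[OF \<sigma>]])
       (auto simp: product_sigma_finite_def lborel.sigma_finite_measure_axioms)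
  finally show ?thesis
    by (simp add: prod_ennreal)
qed

lemma nn_integral_gaussian_PiM:
  assumes I: "finite I" and \<sigma>: "\<sigma> > 0"
  shows "(\<integral>\<^sup>+ y. ennreal (\<Prod>i\<in>I. normal_density (\<mu> i) \<sigma> (y i)) \<partial>PiM I (\<lambda>_. lborel)) = 1"
proof -
  interpret product_sigma_finite "\<lambda>_. lborel :: real measure"
    by (auto simp: product_sigma_finite_def lborel.sigma_finite_measure_axioms)
  have "(\<integral>\<^sup>+ y. ennreal (\<Prod>i\<in>I. normal_density (\<mu> i) \<sigma> (y i)) \<partial>PiM I (\<lambda>_. lborel))
    = (\<integral>\<^sup>+ y. (\<Prod>i\<in>I. ennreal (normal_density (\<mu> i) \<sigma> (y i))) \<partial>PiM I (\<lambda>_. lborel))"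
    by (simp add: prod_ennreal)
  also have "\<dots> = (\<Prod>i\<in>I. \<integral>\<^sup>+ t. ennreal (normal_density (\<mu> i) \<sigma> t) \<partial>lborel)"
    using I by (rule product_nn_integral_prod) measurable
  also have "\<dots> = 1"
    using \<sigma> by (simp add: nn_integral_eq_integral)
  finally show ?thesis .
qed

section \<open>The two-point lower bound\<close>

text \<open>The geometric mean of two Gaussian densities is the density centred at the midpoint,
  scaled by their Hellinger affinity. Completing the square in the exponents gives this.\<close>

lemma normal_density_mult:
  "normal_density a \<sigma> t * normal_density b \<sigma> t
    = (exp (- (a - b)\<^sup>2 / (8 * \<sigma>\<^sup>2)) * normal_density ((a + b) / 2) \<sigma> t)\<^sup>2"
proof (cases "\<sigma> = 0")
  case False
  have "- (t - a)\<^sup>2 / (2 * \<sigma>\<^sup>2) + - (t - b)\<^sup>2 / (2 * \<sigma>\<^sup>2)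
     = 2 * (- (a - b)\<^sup>2 / (8 * \<sigma>\<^sup>2) + - (t - (a + b) / 2)\<^sup>2 / (2 * \<sigma>\<^sup>2))"
    using False by (simp add: field_simps power2_eq_square)
  then show ?thesis
    by (simp add: normal_density_def power_mult_distrib power_divide exp_double exp_add power2_eq_square
        flip: exp_double exp_add)
\<comment> \<open>For \<open>\<sigma> = 0\<close> division by zero makes every
  \<open>normal_density\<close> vanish.\<close>
qed (simp add: normal_density_def)

text \<open>
  Cauchy--Schwarz gives \<open>(a - b)\<^sup>2 * p * q / (p + q) \<le> (z - a)\<^sup>2 * p + (z - b)\<^sup>2 * q\<close>, while AM--GM
  bounds the geometric mean \<open>w\<close> by \<open>p * q / (p + q) + (p + q) / 4\<close>.
\<close>

lemma two_point_pointwise: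
  fixes p q :: real
  assumes p: "p > 0" and q: "q > 0" and w: "w\<^sup>2 = p * q"
  shows "(a - b)\<^sup>2 * w \<le> (z - a)\<^sup>2 * p + (z - b)\<^sup>2 * q + (a - b)\<^sup>2 / 4 * (p + q)"
proof -
  define s where "s = p + q"
  have s: "s > 0" using p q by (simp add: s_def)
  have "(a - b)\<^sup>2 * (p * q) \<le> ((z - a)\<^sup>2 * p + (z - b)\<^sup>2 * q) * s"
  proof -
    have "((z - a)\<^sup>2 * p + (z - b)\<^sup>2 * q) * s - (a - b)\<^sup>2 * (p * q) = ((z - a) * p + (z - b) * q)\<^sup>2"
      unfolding s_def by (simp add: power2_eq_square algebra_simps)
    then show ?thesis by (metis diff_ge_0_iff_ge zero_le_power2)
  qed
  moreover have "w * s \<le> p * q + s * s / 4"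
    using zero_le_power2[of "w - s / 2"] w by (simp add: power2_eq_square algebra_simps)
  then have "(a - b)\<^sup>2 * (w * s) \<le> (a - b)\<^sup>2 * (p * q + s * s / 4)"
    by (rule mult_left_mono) simp
  ultimately have "((a - b)\<^sup>2 * w) * s
      \<le> ((z - a)\<^sup>2 * p + (z - b)\<^sup>2 * q + (a - b)\<^sup>2 / 4 * s) * s"
    by (simp add: algebra_simps)
  then show ?thesis
    using s by (simp add: s_def)
qed

text \<open>Integrate \<open>two_point_pointwise\<close> with the two densities as \<open>p\<close>
  and \<open>q\<close>. The left side yields the Hellinger affinity, at least 7/8; the last term on
  the right costs 1/2 because each density has mass 1; what remains is 7/8 - 1/2 = 3/8.\<close>

lemma two_point_gaussian_bound:
  fixes f :: "('a \<Rightarrow> real) \<Rightarrow> real"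
  defines "N \<equiv> \<lambda>I \<sigma>. PiM I (\<lambda>_. density lborel (\<lambda>t. ennreal (normal_density 0 \<sigma> t)))"
  assumes I: "finite I" and \<sigma>: "\<sigma> > 0"
    and f [measurable]: "f \<in> borel_measurable (PiM I (\<lambda>_. borel))"
    and close: "(\<Sum>i\<in>I. (\<mu> i - \<nu> i)\<^sup>2) \<le> \<sigma>\<^sup>2"
  shows "ennreal (3 / 8 * (a - b)\<^sup>2)
    \<le> (\<integral>\<^sup>+ \<epsilon>. ennreal ((f (\<lambda>i\<in>I. \<mu> i + \<epsilon> i) - a)\<^sup>2) \<partial>N I \<sigma>)
      + (\<integral>\<^sup>+ \<epsilon>. ennreal ((f (\<lambda>i\<in>I. \<nu> i + \<epsilon> i) - b)\<^sup>2) \<partial>N I \<sigma>)"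
proof -
  let ?L = "PiM I (\<lambda>_. lborel) :: ('a \<Rightarrow> real) measure"
  define P where "P = (\<lambda>\<mu> y. \<Prod>i\<in>I. normal_density (\<mu> i) \<sigma> (y i))"
  have P_pos: "P \<mu> y > 0" for \<mu> y
    unfolding P_def using \<sigma> by (intro prod_pos) (simp add: normal_density_pos)
  have P_meas [measurable]: "P \<mu> \<in> borel_measurable ?L" for \<mu>
    unfolding P_def by measurable
  have P_total: "(\<integral>\<^sup>+ y. ennreal (P \<mu> y) \<partial>?L) = 1" for \<mu>
    unfolding P_def using I \<sigma> by (rule nn_integral_gaussian_PiM)
  have [measurable]: "f \<in> borel_measurable ?L"
    using f by (simp cong: measurable_cong_sets sets_PiM_cong)
  have change: "(\<integral>\<^sup>+ \<epsilon>. ennreal ((f (\<lambda>i\<in>I. \<mu> i + \<epsilon> i) - a)\<^sup>2) \<partial>N I \<sigma>)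
    = (\<integral>\<^sup>+ y. ennreal ((f y - a)\<^sup>2 * P \<mu> y) \<partial>?L)" for \<mu> a
  proof -
    have g: "(\<lambda>\<epsilon>. \<lambda>i\<in>I. \<mu> i + \<epsilon> i) \<in> measurable (N I \<sigma>) (PiM I (\<lambda>_. borel))"
      unfolding N_def by measurable
    have "(\<integral>\<^sup>+ \<epsilon>. ennreal ((f (\<lambda>i\<in>I. \<mu> i + \<epsilon> i) - a)\<^sup>2) \<partial>N I \<sigma>)
      = (\<integral>\<^sup>+ y. ennreal ((f y - a)\<^sup>2) \<partial>distr (N I \<sigma>) (PiM I (\<lambda>_. borel)) (\<lambda>\<epsilon>. \<lambda>i\<in>I. \<mu> i + \<epsilon> i))"
      using g by (subst nn_integral_distr) auto
    also have "\<dots> = (\<integral>\<^sup>+ y. ennreal ((f y - a)\<^sup>2) \<partial>density ?L (\<lambda>y. ennreal (P \<mu> y)))"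
      unfolding N_def P_def using I \<sigma> by (simp add: distr_shift_gaussian_PiM)
    also have "\<dots> = (\<integral>\<^sup>+ y. ennreal (P \<mu> y) * ennreal ((f y - a)\<^sup>2) \<partial>?L)"
      by (rule nn_integral_density) measurable
    also have "\<dots> = (\<integral>\<^sup>+ y. ennreal ((f y - a)\<^sup>2 * P \<mu> y) \<partial>?L)"
      by (intro nn_integral_cong) (simp add: ennreal_mult' mult.commute less_imp_le[OF P_pos])
    finally show ?thesis .
  qed
  \<comment> \<open>\<open>r\<close> is the affinity of the two product laws, and \<open>P m\<close>
    is the density at the midpoint, so \<open>r * P m y\<close> is the geometric mean of
    \<open>P \<mu> y\<close> and \<open>P \<nu> y\<close>.\<close>
  define r where "r = exp (- (\<Sum>i\<in>I. (\<mu> i - \<nu> i)\<^sup>2) / (8 * \<sigma>\<^sup>2))"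
  define m where "m = (\<lambda>i. (\<mu> i + \<nu> i) / 2)"
  have w: "(r * P m y)\<^sup>2 = P \<mu> y * P \<nu> y" for y
  proof -
    have "r = (\<Prod>i\<in>I. exp (- (\<mu> i - \<nu> i)\<^sup>2 / (8 * \<sigma>\<^sup>2)))"
      unfolding r_def using I by (simp add: exp_sum sum_divide_distrib flip: sum_negf)
    then show ?thesis
      unfolding P_def m_def by (simp add: normal_density_mult flip: prod.distrib prod_power_distrib)
  qed
  have r: "r \<ge> 7 / 8"
  proof -
    have "- (\<Sum>i\<in>I. (\<mu> i - \<nu> i)\<^sup>2) / (8 * \<sigma>\<^sup>2) \<ge> - 1 / 8"
      using close \<sigma> by (simp add: field_simps)
    then have "r \<ge> exp (- 1 / 8)"
      unfolding r_def by (simp only: exp_le_cancel_iff)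
    then show ?thesis
      using exp_ge_add_one_self[of "- 1 / 8 :: real"] by linarith
  qed
  let ?R = "(\<integral>\<^sup>+ y. ennreal ((f y - a)\<^sup>2 * P \<mu> y) \<partial>?L) + (\<integral>\<^sup>+ y. ennreal ((f y - b)\<^sup>2 * P \<nu> y) \<partial>?L)"
  have "ennreal (3 / 8 * (a - b)\<^sup>2) + ennreal ((a - b)\<^sup>2 / 2) = ennreal ((a - b)\<^sup>2 * (7 / 8))"
    by (simp flip: ennreal_plus)
  also have "\<dots> \<le> ennreal ((a - b)\<^sup>2 * r)"
    using r by (intro ennreal_leI mult_left_mono) auto
  also have "\<dots> = (\<integral>\<^sup>+ y. ennreal ((a - b)\<^sup>2 * r) * ennreal (P m y) \<partial>?L)"
    by (simp add: nn_integral_cmult P_total)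
  also have "\<dots> \<le> (\<integral>\<^sup>+ y. ennreal ((f y - a)\<^sup>2 * P \<mu> y) + ennreal ((f y - b)\<^sup>2 * P \<nu> y)
      + ennreal ((a - b)\<^sup>2 / 4) * (ennreal (P \<mu> y) + ennreal (P \<nu> y)) \<partial>?L)"
  proof (rule nn_integral_mono)
    fix y
    have "(a - b)\<^sup>2 * (r * P m y)
      \<le> (f y - a)\<^sup>2 * P \<mu> y + (f y - b)\<^sup>2 * P \<nu> y + (a - b)\<^sup>2 / 4 * (P \<mu> y + P \<nu> y)"
      by (rule two_point_pointwise[OF P_pos P_pos w])
    from ennreal_leI[OF this]
    show "ennreal ((a - b)\<^sup>2 * r) * ennreal (P m y)
      \<le> ennreal ((f y - a)\<^sup>2 * P \<mu> y) + ennreal ((f y - b)\<^sup>2 * P \<nu> y)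
        + ennreal ((a - b)\<^sup>2 / 4) * (ennreal (P \<mu> y) + ennreal (P \<nu> y))"
      using P_pos[THEN less_imp_le]
      by (simp add: mult.assoc flip: ennreal_plus ennreal_mult' ennreal_mult'')
  qed
  also have "\<dots> = ?R + ennreal ((a - b)\<^sup>2 / 4) * (1 + 1)"
    by (simp add: nn_integral_add nn_integral_cmult P_total)
  also have "ennreal ((a - b)\<^sup>2 / 4) * (1 + 1) = ennreal ((a - b)\<^sup>2 / 2)"
    using ennreal_plus[of "(a - b)\<^sup>2 / 4" "(a - b)\<^sup>2 / 4"] by (simp add: mult_2_right)
  \<comment> \<open>Subtraction is delicate in \<open>ennreal\<close>, so the common summand is kept
    on both sides and cancelled, which its finiteness permits.\<close>
  finally have "ennreal ((a - b)\<^sup>2 / 2) + ennreal (3 / 8 * (a - b)\<^sup>2) \<le> ennreal ((a - b)\<^sup>2 / 2) + ?R"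
    by (simp only: add.commute)
  then show ?thesis
    unfolding change by (subst (asm) ennreal_add_left_cancel_le) auto
qed

section \<open>Assouad's lemma for Gaussian data\<close>

lemma measurable_shift_component:
  assumes T: "T \<in> measurable (PiM I (\<lambda>_. borel)) (PiM I (\<lambda>_. borel))" and "x \<in> I"
  shows "(\<lambda>\<epsilon>. T (\<lambda>i\<in>I. c i + \<epsilon> i) x :: real)
    \<in> borel_measurable (PiM I (\<lambda>_. density lborel (\<lambda>t. ennreal (normal_density 0 \<sigma> t))))"
    (is "_ \<in> borel_measurable ?N")
proof -
  have "(\<lambda>\<epsilon>. \<lambda>i\<in>I. c i + \<epsilon> i) \<in> measurable ?N (PiM I (\<lambda>_. borel))" by measurable
  from measurable_compose[OF measurable_compose[OF this T] measurable_component_singleton[OF assms(2)]]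
  show ?thesis .
qed

text \<open>The supremum dominates the average over \<Omega>. For each coordinate \<open>x\<close>,
  the map \<open>\<phi> x\<close> matches every configuration with one that is hard to tell apart
  but differs at \<open>x\<close>, and the two-point bound applies to each such pair. Since
  \<open>\<phi> x\<close> is a bijection, every risk is counted twice, which halves 3/8 to
  3/16.\<close>

lemma assouad_gaussian:
  fixes \<mu> :: "'w \<Rightarrow> 'a \<Rightarrow> real"
  assumes I: "finite I" and \<sigma>: "\<sigma> > 0" and \<Omega>: "finite \<Omega>" "\<Omega> \<noteq> {}"
    and T [measurable]: "T \<in> measurable (PiM I (\<lambda>_. borel)) (PiM I (\<lambda>_. borel))"
    and bij: "\<And>x. x \<in> I \<Longrightarrow> bij_betw (\<phi> x) \<Omega> \<Omega>"
    and close: "\<And>x \<omega>. x \<in> I \<Longrightarrow> \<omega> \<in> \<Omega> \<Longrightarrow> (\<Sum>i\<in>I. (\<mu> \<omega> i - \<mu> (\<phi> x \<omega>) i)\<^sup>2) \<le> \<sigma>\<^sup>2"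
    and gap: "\<And>x \<omega>. x \<in> I \<Longrightarrow> \<omega> \<in> \<Omega> \<Longrightarrow> d x \<le> (\<mu> \<omega> x - \<mu> (\<phi> x \<omega>) x)\<^sup>2"
    and d: "\<And>x. x \<in> I \<Longrightarrow> 0 \<le> d x"
  shows "ennreal (3 / 16 * (\<Sum>x\<in>I. d x))
    \<le> (SUP \<omega>\<in>\<Omega>. \<integral>\<^sup>+ \<epsilon>. ennreal (\<Sum>x\<in>I. (T (\<lambda>i\<in>I. \<mu> \<omega> i + \<epsilon> i) x - \<mu> \<omega> x)\<^sup>2)
        \<partial>PiM I (\<lambda>_. density lborel (\<lambda>t. ennreal (normal_density 0 \<sigma> t))))"
    (is "_ \<le> (SUP \<omega>\<in>\<Omega>. ?total \<omega>)")
proof -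
  let ?N = "PiM I (\<lambda>_. density lborel (\<lambda>t. ennreal (normal_density 0 \<sigma> t)))"
  define R where "R x \<omega> = (\<integral>\<^sup>+ \<epsilon>. ennreal ((T (\<lambda>i\<in>I. \<mu> \<omega> i + \<epsilon> i) x - \<mu> \<omega> x)\<^sup>2) \<partial>?N)" for x \<omega>
  note R_meas = measurable_shift_component[OF T, measurable]
  have total: "?total \<omega> = (\<Sum>x\<in>I. R x \<omega>)" for \<omega>
  proof -
    have "?total \<omega> = (\<integral>\<^sup>+ \<epsilon>. (\<Sum>x\<in>I. ennreal ((T (\<lambda>i\<in>I. \<mu> \<omega> i + \<epsilon> i) x - \<mu> \<omega> x)\<^sup>2)) \<partial>?N)"
      by (intro nn_integral_cong) (simp add: sum_ennreal)
    also have "\<dots> = (\<Sum>x\<in>I. R x \<omega>)"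
      unfolding R_def by (rule nn_integral_sum) (use R_meas in simp)
    finally show ?thesis .
  qed
  have "of_nat (card \<Omega>) * ennreal (3 / 16 * d x) \<le> (\<Sum>\<omega>\<in>\<Omega>. R x \<omega>)" if x: "x \<in> I" for x
  proof -
    have "2 * (of_nat (card \<Omega>) * ennreal (3 / 16 * d x)) = (\<Sum>\<omega>\<in>\<Omega>. ennreal (3 / 8 * d x))"
    proof -
      have "2 * ennreal (3 / 16 * d x) = ennreal (3 / 8 * d x)"
        using ennreal_mult''[of "3 / 16 * d x" 2] d[OF x] by simp
      then show ?thesis by (simp add: mult.left_commute)
    qed
    also have "\<dots> \<le> (\<Sum>\<omega>\<in>\<Omega>. R x \<omega> + R x (\<phi> x \<omega>))"
    proof (rule sum_mono)
      fix \<omega> assume \<omega>: "\<omega> \<in> \<Omega>"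
      have "ennreal (3 / 8 * d x) \<le> ennreal (3 / 8 * (\<mu> \<omega> x - \<mu> (\<phi> x \<omega>) x)\<^sup>2)"
        using gap[OF x \<omega>] by (intro ennreal_leI) simp
      also have "\<dots> \<le> R x \<omega> + R x (\<phi> x \<omega>)"
        unfolding R_def using x by (intro two_point_gaussian_bound I \<sigma> close \<omega>
            measurable_compose[OF T measurable_component_singleton])
      finally show "ennreal (3 / 8 * d x) \<le> R x \<omega> + R x (\<phi> x \<omega>)" .
    qed
    \<comment> \<open>Reindexing along \<open>\<phi> x\<close> turns the second summand into the
      first.\<close>
    also have "\<dots> = 2 * (\<Sum>\<omega>\<in>\<Omega>. R x \<omega>)"
      using sum.reindex_bij_betw[OF bij[OF x], of "R x"] by (simp add: sum.distrib mult_2)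
    finally show ?thesis
      by (simp add: ennreal_mult_le_mult_iff)
  qed
  then have "(\<Sum>x\<in>I. of_nat (card \<Omega>) * ennreal (3 / 16 * d x)) \<le> (\<Sum>x\<in>I. \<Sum>\<omega>\<in>\<Omega>. R x \<omega>)"
    by (rule sum_mono)
  also have "\<dots> = (\<Sum>\<omega>\<in>\<Omega>. ?total \<omega>)"
    unfolding total by (rule sum.swap)
  also have "\<dots> \<le> (\<Sum>\<omega>\<in>\<Omega>. SUP \<omega>\<in>\<Omega>. ?total \<omega>)"
    by (intro sum_mono SUP_upper)
  finally have "of_nat (card \<Omega>) * (\<Sum>x\<in>I. ennreal (3 / 16 * d x)) \<le> of_nat (card \<Omega>) * (SUP \<omega>\<in>\<Omega>. ?total \<omega>)"
    by (simp add: sum_distrib_left)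
  moreover have "(of_nat (card \<Omega>) :: ennreal) \<noteq> 0"
    using \<Omega> by simp
  ultimately have "(\<Sum>x\<in>I. ennreal (3 / 16 * d x)) \<le> (SUP \<omega>\<in>\<Omega>. ?total \<omega>)"
    by (subst (asm) ennreal_mult_le_mult_iff) auto
  then show ?thesis
    using d by (simp add: sum_ennreal sum_distrib_left)
qed

section \<open>Choice of block length and step height\<close>

text \<open>\<open>s\<close> and \<open>h\<close> are a block length and a step height. At most
  \<open>2 * l / s\<close> blocks fit into \<open>l\<close> vertices, so
  \<open>2 * l * h \<le> v * s\<close> keeps the staircase within the budget \<open>v\<close>;
  \<open>s * h^2 \<le> \<sigma>^2\<close> makes one block undetectable. \<open>N\<close> stands for
  the power of \<open>n\<close> whose ceiling is \<open>l\<close>.\<close>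

lemma step_scale_exists:
  fixes v \<sigma> N :: real and l :: nat
  assumes v: "v \<ge> 0" and \<sigma>: "\<sigma> > 0" and l: "l \<ge> 1" and N: "0 < N" "N \<le> real l"
  shows "\<exists>s h. 1 \<le> s \<and> s \<le> l \<and> 0 \<le> h \<and> 2 * real l * h \<le> v * real s \<and> real s * h\<^sup>2 \<le> \<sigma>\<^sup>2 \<and>
    min (N * \<sigma>\<^sup>2) (min ((v * \<sigma>\<^sup>2) powr (2 / 3) * N powr (1 / 3)) (N * v\<^sup>2)) \<le> 4 * (real l * h\<^sup>2)"
    (is "\<exists>s h. _ \<and> _ \<and> _ \<and> _ \<and> _ \<and> ?m \<le> _")
proof (cases "v = 0")
  case True
  \<comment> \<open>With no budget the minimum is 0, so a zero step height suffices.\<close>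
  then show ?thesis
    using l N by (intro exI[of _ 1] exI[of _ 0]) auto
next
  case False
  with v have v: "v > 0" by simp
  let ?l = "real l"
  have l0: "?l > 0" using l by simp
  \<comment> \<open>Up to constants, \<open>x\<close> is the block length at which the height
    allowed by the budget, \<open>v * x / l\<close>, equals the height allowed by the noise,
    \<open>\<sigma> / sqrt x\<close>. The cases below clip it to the interval from 1 to
    \<open>l\<close>.\<close>
  define x where "x = (?l * \<sigma> / v) powr (2 / 3)"
  have x: "x > 0" using l0 \<sigma> v by (simp add: x_def)
  have "x ^ 3 = (?l * \<sigma> / v) powr 2"
    unfolding x_def by (simp add: powr_powr flip: powr_numeral)
  then have x3: "x ^ 3 * v\<^sup>2 = ?l\<^sup>2 * \<sigma>\<^sup>2"
    using l0 \<sigma> v by (simp add: power_divide power_mult_distrib)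
  consider "?l \<le> x" | "x \<le> 1" | "1 < x" "x < ?l" by linarith
  then show ?thesis
  proof cases
    case 1
    \<comment> \<open>One block fills the path, with height \<open>v / 2\<close>; the third term of
      the minimum is attained.\<close>
    have "?l ^ 3 * v\<^sup>2 \<le> ?l\<^sup>2 * \<sigma>\<^sup>2"
      unfolding x3[symmetric] using 1 by (intro mult_right_mono power_mono) auto
    then have "?l\<^sup>2 * (?l * v\<^sup>2) \<le> ?l\<^sup>2 * \<sigma>\<^sup>2"
      by (simp add: power3_eq_cube power2_eq_square algebra_simps)
    then have "?l * v\<^sup>2 \<le> \<sigma>\<^sup>2"
      using l0 by simp
    moreover have "?l * (v / 2)\<^sup>2 \<le> ?l * v\<^sup>2"
      using v by (intro mult_left_mono power_mono) auto
    ultimately have "?l * (v / 2)\<^sup>2 \<le> \<sigma>\<^sup>2"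
      by linarith
    moreover have "?m \<le> 4 * (?l * (v / 2)\<^sup>2)"
      using N by (simp add: power_divide min_le_iff_disj mult_right_mono)
    ultimately show ?thesis
      using v l by (intro exI[of _ l] exI[of _ "v / 2"]) auto
  next
    case 2
    \<comment> \<open>Blocks are single vertices, with height \<open>\<sigma> / 2\<close>; the first
      term of the minimum serves.\<close>
    have "x ^ 3 \<le> 1" using 2 x by (simp add: power_le_one)
    then have "?l\<^sup>2 * \<sigma>\<^sup>2 \<le> v\<^sup>2"
      unfolding x3[symmetric] using mult_right_mono[of "x ^ 3" 1 "v\<^sup>2"] by simp
    then have "?l * \<sigma> \<le> v"
      using v by (simp add: power2_le_imp_le[of "?l * \<sigma>" v] power_mult_distrib)
    moreover have "(\<sigma> / 2)\<^sup>2 \<le> \<sigma>\<^sup>2"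
      using \<sigma> by (intro power_mono) auto
    moreover have "?m \<le> 4 * (?l * (\<sigma> / 2)\<^sup>2)"
      using N by (simp add: power_divide min_le_iff_disj mult_right_mono)
    ultimately show ?thesis
      using \<sigma> l by (intro exI[of _ 1] exI[of _ "\<sigma> / 2"]) auto
  next
    case 3
    \<comment> \<open>Rounding up at most doubles \<open>x\<close>, as \<open>1 < x\<close>. The
      factor 1/2 in \<open>h\<close> matches the factor 2 in the budget condition and also absorbs
      this doubling in \<open>s * h^2\<close>.\<close>
    define s where "s = nat \<lceil>x\<rceil>"
    define h where "h = v * x / (2 * ?l)"
    have s: "1 \<le> s" "s \<le> l" "x \<le> real s" "real s \<le> 2 * x"
      unfolding s_def using 3 by linarith+
    have h: "h \<ge> 0" using v x l0 by (simp add: h_def)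
    have "real s * h\<^sup>2 \<le> 2 * x * h\<^sup>2"
      using s by (intro mult_right_mono) auto
    also have "\<dots> = x ^ 3 * v\<^sup>2 / (2 * ?l\<^sup>2)"
      by (simp add: h_def power2_eq_square power3_eq_cube)
    also have "\<dots> = \<sigma>\<^sup>2 / 2"
      unfolding x3 using l0 by simp
    also have "\<dots> \<le> \<sigma>\<^sup>2" by simp
    finally have sh: "real s * h\<^sup>2 \<le> \<sigma>\<^sup>2" .
    have "(v * \<sigma>\<^sup>2) powr (2 / 3) * N powr (1 / 3) \<le> (v * \<sigma>\<^sup>2) powr (2 / 3) * ?l powr (1 / 3)"
      using N by (intro mult_left_mono powr_mono2) auto
    also have "\<dots> = v\<^sup>2 * x\<^sup>2 / ?l"
    proof -
      \<comment> \<open>Both sides are positive, and after taking logarithms the fractional powers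
        become linear arithmetic.\<close>
      have L: "ln ((v * \<sigma>\<^sup>2) powr (2 / 3) * ?l powr (1 / 3)) = ln (v\<^sup>2 * x\<^sup>2 / ?l)"
        using v \<sigma> l0 by (simp add: x_def ln_mult ln_div ln_powr ln_realpow field_simps)
      show ?thesis
        by (rule ln_inj_iff[THEN iffD1, OF _ _ L]) (use v \<sigma> l0 x in auto)
    qed
    also have "\<dots> = 4 * (?l * h\<^sup>2)"
      using l0 by (simp add: h_def power2_eq_square)
    finally have "?m \<le> 4 * (?l * h\<^sup>2)"
      by linarith
    moreover have "2 * ?l * h \<le> v * real s"
      using s v l0 by (simp add: h_def)
    ultimately show ?thesis
      using s h sh by blast
  qed
qed

section \<open>Staircase flows on the tree\<close>

lemma tree_vertices_eq:
  "tree_vertices \<alpha> n = insert Root ((\<lambda>(j, i). Node j i) ` ({1..num_paths \<alpha> n} \<times> {1..path_length \<alpha> n}))"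
  by (auto simp: tree_vertices_def)

lemma finite_tree_vertices: "finite (tree_vertices \<alpha> n)"
  by (simp add: tree_vertices_eq)

lemma sum_tree_vertices:
  fixes f :: "vertex \<Rightarrow> real"
  shows "sum f (tree_vertices \<alpha> n)
    = f Root + (\<Sum>j = 1..num_paths \<alpha> n. \<Sum>i = 1..path_length \<alpha> n. f (Node j i))"
proof -
  have inj: "inj_on (\<lambda>(j, i). Node j i) A" for A
    by (auto simp: inj_on_def)
  show ?thesis
    unfolding tree_vertices_eq
    by (subst sum.insert) (auto simp: sum.reindex[OF inj] sum.cartesian_product o_def intro!: sum.cong)
qed

text \<open>
  The pair \<open>(j, b)\<close> stands for the \<open>b\<close>-th block of path \<open>j\<close>, counted from 0, and \<open>D\<close> is the set of
  raised blocks. Raising a block by one full step never destroys monotonicity.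
\<close>

definition block_flow ::
    "real \<Rightarrow> nat \<Rightarrow> real \<Rightarrow> (nat \<Rightarrow> nat) \<Rightarrow> (nat \<Rightarrow> real) \<Rightarrow> (nat \<times> nat) set \<Rightarrow> vertex \<Rightarrow> real" where
  "block_flow \<alpha> n V s h D = (\<lambda>x\<in>tree_vertices \<alpha> n. case x of Root \<Rightarrow> V
     | Node j i \<Rightarrow> h j * (real ((path_length \<alpha> n - 1) div s j - (i - 1) div s j)
         + of_bool ((j, (i - 1) div s j) \<in> D)))"

lemma block_flow_Root: "block_flow \<alpha> n V s h D Root = V"
  by (simp add: block_flow_def tree_vertices_def)

lemma block_flow_Node:
  assumes "j \<in> {1..num_paths \<alpha> n}" "i \<in> {1..path_length \<alpha> n}"
  shows "block_flow \<alpha> n V s h D (Node j i)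
    = h j * (real ((path_length \<alpha> n - 1) div s j - (i - 1) div s j) + of_bool ((j, (i - 1) div s j) \<in> D))"
  using assms by (simp add: block_flow_def tree_vertices_def)

text \<open>The hypothesis \<open>top\<close> bounds the largest possible value at the head of path
  \<open>j\<close>: the baseline there is the last block index, and raising adds one more step. The
  root always carries exactly \<open>V\<close>.\<close>

lemma block_flow_in_bounded_flows:
  assumes l: "1 \<le> path_length \<alpha> n"
    and h: "\<And>j. j \<in> {1..num_paths \<alpha> n} \<Longrightarrow> 0 \<le> h j"
    and top: "\<And>j. j \<in> {1..num_paths \<alpha> n} \<Longrightarrow> h j * (real ((path_length \<alpha> n - 1) div s j) + 1) \<le> v j"
    and v: "(\<Sum>j = 1..num_paths \<alpha> n. v j) \<le> V"
  shows "block_flow \<alpha> n V s h D \<in> bounded_flows \<alpha> n V"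
proof -
  let ?F = "block_flow \<alpha> n V s h D"
  let ?l = "path_length \<alpha> n"
  have "?F (Node j 1) \<le> v j" if j: "j \<in> {1..num_paths \<alpha> n}" for j
  proof -
    have "?F (Node j 1) \<le> h j * (real ((?l - 1) div s j) + 1)"
      using j l h[OF j] by (simp add: block_flow_Node mult_left_mono)
    then show ?thesis using top[OF j] by linarith
  qed
  then have "(\<Sum>j = 1..num_paths \<alpha> n. ?F (Node j 1)) \<le> V"
    using v sum_mono[of "{1..num_paths \<alpha> n}" "\<lambda>j. ?F (Node j 1)" v] by fastforce
  moreover have "?F (Node j (Suc i)) \<le> ?F (Node j i)"
    if j: "j \<in> {1..num_paths \<alpha> n}" and i: "i \<in> {1..<?l}" for j i
  proof -
    \<comment> \<open>Vertices are counted from 1 and blocks from 0, so \<open>?r\<close> is the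
      block of vertex \<open>Suc i\<close>.\<close>
    let ?K = "(?l - 1) div s j" and ?q = "(i - 1) div s j" and ?r = "i div s j"
    have "?q \<le> ?r" "?r \<le> ?K"
      using i by (auto intro: div_le_mono)
    \<comment> \<open>Inside a block nothing changes; across a boundary the baseline falls by at
      least 1, which pays for a raise of the later block.\<close>
    then have "real (?K - ?r) + of_bool ((j, ?r) \<in> D) \<le> real (?K - ?q) + of_bool ((j, ?q) \<in> D)"
      by (cases "?q = ?r") (auto simp: of_bool_def)
    then show ?thesis
      using j i h[OF j] by (simp add: block_flow_Node mult_left_mono)
  qed
  moreover have "0 \<le> ?F (Node j ?l)" if j: "j \<in> {1..num_paths \<alpha> n}" for j
    using j l h[OF j] by (simp add: block_flow_Node)
  moreover have "?F \<in> tree_vertices \<alpha> n \<rightarrow>\<^sub>E UNIV"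
    by (simp add: block_flow_def)
  ultimately show ?thesis
    by (simp add: bounded_flows_def flows_def block_flow_Root)
qed

text \<open>Symmetric difference with a singleton: the switch of one coordinate when a power set is
  viewed as a cube.\<close>

definition flip :: "'a \<Rightarrow> 'a set \<Rightarrow> 'a set" where
  "flip b D = (if b \<in> D then D - {b} else insert b D)"

lemma mem_flip: "x \<in> flip b D \<longleftrightarrow> (if x = b then x \<notin> D else x \<in> D)"
  by (auto simp: flip_def)

lemma bij_betw_flip:
  assumes "b \<in> B"
  shows "bij_betw (flip b) (Pow B) (Pow B)"
  by (rule bij_betw_byWitness[where f' = "flip b"]) (use assms in \<open>auto simp: flip_def\<close>)

lemma block_flow_flip_diff:
  assumes "j \<in> {1..num_paths \<alpha> n}" "i \<in> {1..path_length \<alpha> n}"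
  shows "(block_flow \<alpha> n V s h D (Node j i) - block_flow \<alpha> n V s h (flip b D) (Node j i))\<^sup>2
    = (if (j, (i - 1) div s j) = b then (h j)\<^sup>2 else 0)"
  using assms by (auto simp: block_flow_Node mem_flip of_bool_def algebra_simps)

text \<open>Only the vertices of the switched block change, each by \<open>h j\<close>, and a block
  has at most \<open>s j\<close> vertices.\<close>

lemma block_flow_flip_close:
  assumes j: "j \<in> {1..num_paths \<alpha> n}" and s: "1 \<le> s j"
  shows "(\<Sum>x\<in>tree_vertices \<alpha> n.
      (block_flow \<alpha> n V s h D x - block_flow \<alpha> n V s h (flip (j, b) D) x)\<^sup>2) \<le> real (s j) * (h j)\<^sup>2"
    (is "(\<Sum>x\<in>_. ?d x) \<le> _")
proof -
  let ?l = "path_length \<alpha> n"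
  have "(\<Sum>x\<in>tree_vertices \<alpha> n. ?d x) = (\<Sum>k = 1..num_paths \<alpha> n. \<Sum>i = 1..?l. ?d (Node k i))"
    by (simp add: sum_tree_vertices block_flow_Root)
  also have "\<dots> = (\<Sum>k = 1..num_paths \<alpha> n. if k = j then \<Sum>i = 1..?l. ?d (Node j i) else 0)"
    by (intro sum.cong refl) (auto simp: block_flow_flip_diff)
  also have "\<dots> = (\<Sum>i = 1..?l. ?d (Node j i))"
    using j by simp
  also have "\<dots> = (\<Sum>i = 1..?l. if (i - 1) div s j = b then (h j)\<^sup>2 else 0)"
    using j by (intro sum.cong refl) (simp add: block_flow_flip_diff)
  also have "\<dots> = real (card {i \<in> {1..?l}. (i - 1) div s j = b}) * (h j)\<^sup>2"
    by (simp flip: sum.inter_filter)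
  also have "\<dots> \<le> real (s j) * (h j)\<^sup>2"
  proof (rule mult_right_mono)
    \<comment> \<open>Because of the shift by 1, block \<open>b\<close> starts just after
      \<open>b * s j\<close>, hence the interval is open on the left.\<close>
    have "{i \<in> {1..?l}. (i - 1) div s j = b} \<subseteq> {b * s j<..b * s j + s j}"
    proof
      fix i assume i: "i \<in> {i \<in> {1..?l}. (i - 1) div s j = b}"
      then have "i - 1 = b * s j + (i - 1) mod s j"
        using div_mult_mod_eq[of "i - 1" "s j"] by simp
      moreover have "(i - 1) mod s j < s j"
        using s by simp
      ultimately show "i \<in> {b * s j<..b * s j + s j}"
        unfolding greaterThanAtMost_iff using i by simp linarith
    qed
    from card_mono[OF finite_greaterThanAtMost this]
    show "real (card {i \<in> {1..?l}. (i - 1) div s j = b}) \<le> real (s j)"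
      by simp
  qed simp
  finally show ?thesis .
qed

section \<open>From Assouad's lemma to the minimax risk\<close>

lemma risk_eq:
  assumes T: "T \<in> estimators \<alpha> n"
  shows "risk \<alpha> n \<sigma> T \<mu> = ennreal (1 / real n) *
    (\<integral>\<^sup>+ \<epsilon>. ennreal (\<Sum>x\<in>tree_vertices \<alpha> n. (T (\<lambda>i\<in>tree_vertices \<alpha> n. \<mu> i + \<epsilon> i) x - \<mu> x)\<^sup>2)
      \<partial>PiM (tree_vertices \<alpha> n) (\<lambda>_. density lborel (\<lambda>t. ennreal (normal_density 0 \<sigma> t))))"
proof -
  note measurable_shift_component[OF T[unfolded estimators_def], measurable]
  show ?thesis
    unfolding risk_def noise_def observation_def L2_set_def
    by (subst nn_integral_cmult[symmetric])
       (auto simp: sum_nonneg simp flip: ennreal_mult' intro!: nn_integral_cong)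
qed

text \<open>A single cube governs the blocks of all paths together, so the contributions of the
  paths add up. Each path vertex is tested by switching its own block.\<close>

lemma path_risk_bound:
  assumes \<sigma>: "\<sigma> > 0" and T: "T \<in> estimators \<alpha> n"
    and l: "1 \<le> path_length \<alpha> n"
    and s: "\<And>j. j \<in> {1..num_paths \<alpha> n} \<Longrightarrow> 1 \<le> s j"
    and h: "\<And>j. j \<in> {1..num_paths \<alpha> n} \<Longrightarrow> 0 \<le> h j"
    and sh: "\<And>j. j \<in> {1..num_paths \<alpha> n} \<Longrightarrow> real (s j) * (h j)\<^sup>2 \<le> \<sigma>\<^sup>2"
    and top: "\<And>j. j \<in> {1..num_paths \<alpha> n} \<Longrightarrow> h j * (real ((path_length \<alpha> n - 1) div s j) + 1) \<le> v j"
    and v: "(\<Sum>j = 1..num_paths \<alpha> n. v j) \<le> V"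
  shows "ennreal (3 / (16 * real n) * (\<Sum>j = 1..num_paths \<alpha> n. real (path_length \<alpha> n) * (h j)\<^sup>2))
    \<le> (SUP \<mu>\<in>bounded_flows \<alpha> n V. risk \<alpha> n \<sigma> T \<mu>)"
proof -
  let ?I = "tree_vertices \<alpha> n" and ?F = "block_flow \<alpha> n V s h"
  let ?m = "num_paths \<alpha> n" and ?l = "path_length \<alpha> n"
  \<comment> \<open>This range covers every block index, whatever \<open>s j\<close> is; a pair that
    names no block leaves the flow unchanged and merely repeats it in the average.\<close>
  define B where "B = {1..?m} \<times> {..?l}"
  \<comment> \<open>The root has the same value in every flow of the cube, so it is matched with the
    identity and contributes 0.\<close>
  define \<phi> where "\<phi> = case_vertex id (\<lambda>j i. flip (j, (i - 1) div s j))"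
  define d where "d = case_vertex 0 (\<lambda>j (i :: nat). (h j)\<^sup>2)"
  let ?S = "\<lambda>D. \<integral>\<^sup>+ \<epsilon>. ennreal (\<Sum>x\<in>?I. (T (\<lambda>i\<in>?I. ?F D i + \<epsilon> i) x - ?F D x)\<^sup>2)
        \<partial>PiM ?I (\<lambda>_. density lborel (\<lambda>t. ennreal (normal_density 0 \<sigma> t)))"
  have I: "x = Root \<or> (\<exists>j i. x = Node j i \<and> j \<in> {1..?m} \<and> i \<in> {1..?l})" if "x \<in> ?I" for x
    using that by (auto simp: tree_vertices_def)
  have "ennreal (3 / 16 * (\<Sum>x\<in>?I. d x)) \<le> (SUP D\<in>Pow B. ?S D)"
  proof (rule assouad_gaussian[where \<phi> = \<phi>])
    show "T \<in> measurable (PiM ?I (\<lambda>_. borel)) (PiM ?I (\<lambda>_. borel))"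
      using T by (simp add: estimators_def)
  next
    fix x assume x: "x \<in> ?I"
    show "bij_betw (\<phi> x) (Pow B) (Pow B)"
    proof (cases x)
      case (Node j i)
      have "(i - 1) div s j \<le> i" by (meson div_le_dividend diff_le_self le_trans)
      then have "(j, (i - 1) div s j) \<in> B"
        using I[OF x] Node by (auto simp: B_def simp del: One_nat_def)
      then show ?thesis
        by (simp add: \<phi>_def Node bij_betw_flip)
    qed (simp add: \<phi>_def)
    show "0 \<le> d x"
      by (cases x) (simp_all add: d_def)
    fix D
    show "(\<Sum>i\<in>?I. (?F D i - ?F (\<phi> x D) i)\<^sup>2) \<le> \<sigma>\<^sup>2"
    proof (cases x)
      case (Node j i)
      then have "j \<in> {1..?m}" using I[OF x] by simp
      then show ?thesis
        using block_flow_flip_close[of j \<alpha> n s V h D "(i - 1) div s j"] s sh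
        by (fastforce simp: \<phi>_def Node)
    qed (simp add: \<phi>_def)
    show "d x \<le> (?F D x - ?F (\<phi> x D) x)\<^sup>2"
      using I[OF x] by (auto simp: d_def \<phi>_def block_flow_flip_diff)
  qed (auto simp: finite_tree_vertices \<sigma> B_def)
  from mult_left_mono[OF this, of "ennreal (1 / real n)"]
  have "ennreal (1 / real n) * ennreal (3 / 16 * (\<Sum>x\<in>?I. d x))
    \<le> (SUP D\<in>Pow B. ennreal (1 / real n) * ?S D)"
    by (simp add: SUP_mult_left_ennreal)
  also have "\<dots> = (SUP D\<in>Pow B. risk \<alpha> n \<sigma> T (?F D))"
    by (simp add: risk_eq[OF T])
  also have "\<dots> \<le> (SUP \<mu>\<in>bounded_flows \<alpha> n V. risk \<alpha> n \<sigma> T \<mu>)"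
    by (intro SUP_least SUP_upper block_flow_in_bounded_flows[OF l h top v])
  finally show ?thesis
    by (simp add: sum_tree_vertices d_def mult.commute flip: ennreal_mult')
qed

theorem theorem2p8:
  "\<exists>c::real. c > 0 \<and>
    (\<forall>(\<alpha>::real) (n::nat) (V::real) (\<sigma>::real).
      0 \<le> \<alpha> \<and> \<alpha> \<le> 1 \<and> n \<ge> 1 \<and> V > 0 \<and> \<sigma> > 0 \<longrightarrow>
      (INF T\<in>estimators \<alpha> n. SUP \<mu>\<in>bounded_flows \<alpha> n V. risk \<alpha> n \<sigma> T \<mu>)
      \<ge> (SUP v\<in>{v :: nat \<Rightarrow> real. (\<forall>i\<in>{1..num_paths \<alpha> n}. 0 \<le> v i) \<and>
                                  (\<Sum>i = 1..num_paths \<alpha> n. v i) \<le> V}.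
           ennreal (c / real n * (\<Sum>i = 1..num_paths \<alpha> n.
             min (real n powr (1 - \<alpha>) * \<sigma>\<^sup>2)
               (min ((v i * \<sigma>\<^sup>2) powr (2 / 3) * real n powr ((1 - \<alpha>) / 3))
                 (real n powr (1 - \<alpha>) * (v i)\<^sup>2))))))"
proof (intro exI[of _ "3 / 64"] conjI allI impI SUP_least INF_greatest)
  \<comment> \<open>The constant is 3/16 from \<open>assouad_gaussian\<close>, divided by the 4 of
    \<open>step_scale_exists\<close>.\<close>
  show "(3 / 64 :: real) > 0" by simp
next
  fix \<alpha> V \<sigma> :: real and n :: nat and v :: "nat \<Rightarrow> real" and T
  assume A: "0 \<le> \<alpha> \<and> \<alpha> \<le> 1 \<and> n \<ge> 1 \<and> V > 0 \<and> \<sigma> > 0"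
    and v_in: "v \<in> {v. (\<forall>i\<in>{1..num_paths \<alpha> n}. 0 \<le> v i) \<and> (\<Sum>i = 1..num_paths \<alpha> n. v i) \<le> V}"
    and T: "T \<in> estimators \<alpha> n"
  let ?J = "{1..num_paths \<alpha> n}" and ?l = "path_length \<alpha> n" and ?N = "real n powr (1 - \<alpha>)"
  let ?m = "\<lambda>i. min (?N * \<sigma>\<^sup>2)
    (min ((v i * \<sigma>\<^sup>2) powr (2 / 3) * real n powr ((1 - \<alpha>) / 3)) (?N * (v i)\<^sup>2))"
  have v: "\<And>j. j \<in> ?J \<Longrightarrow> 0 \<le> v j" and v_sum: "(\<Sum>j\<in>?J. v j) \<le> V"
    using v_in by auto
  have N: "0 < ?N" "?N \<le> real ?l"
    using A by (simp_all add: path_length_def real_nat_ceiling_ge)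
  then have l: "1 \<le> ?l" by (cases ?l) auto
  have "\<forall>j\<in>?J. \<exists>s h. 1 \<le> s \<and> s \<le> ?l \<and> 0 \<le> h \<and> 2 * real ?l * h \<le> v j * real s \<and>
      real s * h\<^sup>2 \<le> \<sigma>\<^sup>2 \<and> ?m j \<le> 4 * (real ?l * h\<^sup>2)"
    using step_scale_exists[OF v _ l N] A by (auto simp: powr_powr)
  then obtain s h where sh: "\<And>j. j \<in> ?J \<Longrightarrow> 1 \<le> s j \<and> s j \<le> ?l \<and> 0 \<le> h j \<and>
      2 * real ?l * h j \<le> v j * real (s j) \<and>
      real (s j) * (h j)\<^sup>2 \<le> \<sigma>\<^sup>2 \<and> ?m j \<le> 4 * (real ?l * (h j)\<^sup>2)"
    by metis
  have top: "h j * (real ((?l - 1) div s j) + 1) \<le> v j" if j: "j \<in> ?J" for j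
  proof -
    have "real ((?l - 1) div s j) * real (s j) \<le> real (?l - 1)"
      by (metis div_times_less_eq_dividend of_nat_le_iff of_nat_mult)
    \<comment> \<open>The blocks, the last one completed to full length, cover at most
      \<open>(l - 1) + s j \<le> 2 * l\<close> positions; this is the source of the 2 in
      \<open>step_scale_exists\<close>.\<close>
    then have "(real ((?l - 1) div s j) + 1) * real (s j) \<le> 2 * real ?l"
      using sh[OF j] l by (simp add: distrib_right of_nat_diff)
    then have "h j * ((real ((?l - 1) div s j) + 1) * real (s j)) \<le> h j * (2 * real ?l)"
      using sh[OF j] by (intro mult_left_mono) auto
    also have "\<dots> \<le> v j * real (s j)"
      using sh[OF j] by (simp add: mult_ac)
    finally have "(h j * (real ((?l - 1) div s j) + 1)) * real (s j) \<le> v j * real (s j)"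
      by (simp add: mult.assoc)
    then show ?thesis
      using sh[OF j] by (simp add: mult_le_cancel_right)
  qed
  have "(\<Sum>j\<in>?J. ?m j) \<le> (\<Sum>j\<in>?J. 4 * (real ?l * (h j)\<^sup>2))"
    using sh by (intro sum_mono) blast
  then have "3 / 64 / real n * (\<Sum>j\<in>?J. ?m j) \<le> 3 / 64 / real n * (4 * (\<Sum>j\<in>?J. real ?l * (h j)\<^sup>2))"
    unfolding sum_distrib_left[symmetric] by (rule mult_left_mono) simp
  then have "ennreal (3 / 64 / real n * (\<Sum>j\<in>?J. ?m j))
      \<le> ennreal (3 / (16 * real n) * (\<Sum>j\<in>?J. real ?l * (h j)\<^sup>2))"
    by (intro ennreal_leI) simp
  also have "\<dots> \<le> (SUP \<mu>\<in>bounded_flows \<alpha> n V. risk \<alpha> n \<sigma> T \<mu>)"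
    using A sh by (intro path_risk_bound[OF _ T l _ _ _ top v_sum]) auto
  finally show "ennreal (3 / 64 / real n * (\<Sum>j\<in>?J. ?m j))
      \<le> (SUP \<mu>\<in>bounded_flows \<alpha> n V. risk \<alpha> n \<sigma> T \<mu>)" .
qed

end
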